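(* Let $1<p<\infty$, $0\le\rho\le1$, and let $\sigma:\mathbb{T}\times\mathbb{Z}\to\mathbb{C}$ be a measurable function such that for all integers $0\le\beta\le[1/p]+1$ and $0\le\alpha\le 2$, $$|\partial_x^\beta\Delta_\xi^\alpha\sigma(x,\xi)|\le C_\beta|\xi|^{-\rho-\alpha},\qquad x\in\mathbb{T},\ \xi\in\mathbb{Z},\ \xi\ne0,$$ with constants $C_\beta>0$. Then $\mathrm{Op}(\sigma)$ is bounded from $B^{s}_{\infty,\infty,p}(\mathbb{T})$ into $B^{r}_{\infty,\infty,p}(\mathbb{T})$ for all $0<r<1$ and $0<s\le 1$ with $r+\frac12-\rho\le s\le 1$.
   Context: $\mathbb{T}=[0,2\pi)$ is the one-dimensional torus with normalized Haar measure $dx$; $\widehat f(\xi)=\int_{\mathbb{T}}e^{-ix\xi}f(x)\,dx$ for $\xi\in\mathbb{Z}$. For a symbol $\sigma:\mathbb{T}\times\mathbb{Z}\to\mathbb{C}$, the periodic pseudo-differential operator is $\mathrm{Op}(\sigma)f(x)=\sum_{\xi\in\mathbb{Z}}e^{ix\xi}\sigma(x,\xi)\widehat f(\xi)$. $\Delta_\xi\sigma(x,\xi)=\sigma(x,\xi+1)-\sigma(x,\xi)$ is the difference operator, $\Delta_\xi^\alpha$ its $\alpha$-fold iterate, and $[t]$ denotes the integer part of $t$. $B^{s}_{\infty,\infty,p}(\mathbb{T})$ denotes the Hölder space of order $s$ on $\mathbb{T}$ endowed with the norm $\|f\|_{B^s_{\infty,\infty,p}}=|f|_{\Lambda^s}+\|f\|_{L^p(\mathbb{T})}$,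 where $|f|_{\Lambda^s}=\sup_{x,\,y\ne0}\frac{|f(x-y)-f(x)|}{|y|^s}$. Bounded from $X$ into $Y$ means: there is $C>0$ with $\|\mathrm{Op}(\sigma)f\|_Y\le C\|f\|_X$ for all $f\in C^\infty(\mathbb{T})$. *)

theory Defs
  imports "HOL-Analysis.Analysis"
begin

text \<open>Functions on the torus are \<open>2\<pi>\<close>-periodic functions on the real line, so that translations
  and derivatives at the endpoint are the usual ones on \<open>\<real>\<close>.\<close>

abbreviation periodic_torus :: "(real \<Rightarrow> complex) \<Rightarrow> bool" where
  "periodic_torus f \<equiv> periodic_fun_simple f (2 * pi)"

text \<open>Normalized Haar measure: Lebesgue measure on \<open>[0, 2\<pi>)\<close> divided by \<open>2\<pi>\<close>.
  Its \<open>\<sigma>\<close>-algebra consists of all Lebesgue sets of the line; the complement of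
  \<open>[0, 2\<pi>)\<close> has measure \<open>0\<close>.\<close>

definition haar :: "real measure" where
  "haar = uniform_measure lebesgue {0..<2 * pi}"

definition fourier_coeff :: "(real \<Rightarrow> complex) \<Rightarrow> int \<Rightarrow> complex" where
  "fourier_coeff f \<xi> = (LINT x|haar. exp (- \<i> * of_real (x * of_int \<xi>)) * f x)"

definition Op :: "(real \<Rightarrow> int \<Rightarrow> complex) \<Rightarrow> (real \<Rightarrow> complex) \<Rightarrow> real \<Rightarrow> complex" where
  "Op \<sigma> f x = (\<Sum>\<^sub>\<infinity>\<xi>\<in>UNIV. exp (\<i> * of_real (x * of_int \<xi>)) * \<sigma> x \<xi> * fourier_coeff f \<xi>)"

definition diff_xi :: "(real \<Rightarrow> int \<Rightarrow> complex) \<Rightarrow> real \<Rightarrow> int \<Rightarrow> complex" where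
  "diff_xi \<sigma> = (\<lambda>x \<xi>. \<sigma> x (\<xi> + 1) - \<sigma> x \<xi>)"

definition deriv_x :: "nat \<Rightarrow> (real \<Rightarrow> complex) \<Rightarrow> real \<Rightarrow> complex" where
  "deriv_x n f = ((\<lambda>g x. vector_derivative g (at x)) ^^ n) f"

text \<open>\<open>vector_derivative\<close> is total, hence the existence of the derivatives up to order \<open>n\<close>
  is a separate predicate.\<close>

definition times_differentiable :: "nat \<Rightarrow> (real \<Rightarrow> complex) \<Rightarrow> bool" where
  "times_differentiable n f \<longleftrightarrow> (\<forall>k<n. \<forall>x. deriv_x k f differentiable (at x))"

definition smooth_torus :: "(real \<Rightarrow> complex) set" where
  "smooth_torus = {f. periodic_torus f \<and> (\<forall>n. times_differentiable n f)}"

text \<open>Norms take values in \<open>[0, \<infinity>]\<close>, so that a bound by a finite norm includes membership in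
  the space. For periodic \<open>f\<close>, letting the increment \<open>y\<close> range over all nonzero reals gives the same
  supremum as letting it range over the representatives in \<open>(0, 2\<pi>)\<close> or in
  \<open>[-\<pi>, \<pi>] - {0}\<close>.\<close>

definition holder_seminorm :: "real \<Rightarrow> (real \<Rightarrow> complex) \<Rightarrow> ennreal" where
  "holder_seminorm s f =
     (SUP (x, y)\<in>{(x, y). y \<noteq> 0}. ennreal (cmod (f (x - y) - f x) / \<bar>y\<bar> powr s))"

definition Lp_norm :: "real \<Rightarrow> (real \<Rightarrow> complex) \<Rightarrow> ennreal" where
  "Lp_norm p f =
     (let I = (\<integral>\<^sup>+ x. ennreal (cmod (f x) powr p) \<partial>haar)
      in if I = \<infinity> then \<infinity> else ennreal (enn2real I powr (1 / p)))"

definition B_norm :: "real \<Rightarrow> real \<Rightarrow> (real \<Rightarrow> complex) \<Rightarrow> ennreal" where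
  "B_norm s p f = holder_seminorm s f + Lp_norm p f"

definition bounded_operator ::
  "((real \<Rightarrow> complex) \<Rightarrow> ennreal) \<Rightarrow> ((real \<Rightarrow> complex) \<Rightarrow> ennreal) \<Rightarrow>
   ((real \<Rightarrow> complex) \<Rightarrow> (real \<Rightarrow> complex)) \<Rightarrow> bool" where
  "bounded_operator normX normY T \<longleftrightarrow>
     (\<exists>C::real. C > 0 \<and> (\<forall>f\<in>smooth_torus. normY (T f) \<le> ennreal C * normX f))"

end

theory Submission
  imports Defs
begin

text \<open>The proof is Bernstein's argument for absolutely convergent Fourier series, carried out with the
  symbol in front of the coefficients.

  Let \<open>A\<close> be the Hoelder seminorm of order \<open>s\<close> of \<open>f\<close>. Bessel's inequality for the increment
  \<open>f(x - h) - f(x)\<close> with \<open>h \<sim> 2\<^bsup>-j\<^esup>\<close> bounds the \<open>\<ell>\<^sup>2\<close> norm of the Fourier coefficients over the frequencies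
  \<open>2\<^sup>j \<le> \<bar>k\<bar> < 2\<^bsup>j + 1\<^esup>\<close> by a multiple of \<open>A 2\<^bsup>-s j\<^esup>\<close> (\<open>fourier_l2_shell_le\<close>). By Cauchy-Schwarz their \<open>\<ell>\<^sup>1\<close> norm is
  at most a multiple of \<open>A 2\<^bsup>(1/2 - s) j\<^esup>\<close>, and the decay \<open>\<bar>k\<bar>\<^bsup>-\<rho>\<^esup>\<close> of the symbol improves this to
  \<open>A 2\<^bsup>(1/2 - \<rho> - s) j\<^esup> \<le> A 2\<^bsup>-r j\<^esup>\<close> (\<open>fourier_l1_shell_le\<close>). So the block of \<open>Op \<sigma> f\<close> with these
  frequencies is bounded by a multiple of \<open>A 2\<^bsup>-r j\<^esup>\<close>, and its increments by a multiple of
  \<open>A 2\<^bsup>-r j\<^esup> min 1 (2\<^sup>j \<bar>h\<bar>)\<close>, because a derivative in \<open>x\<close> costs a factor \<open>\<bar>k\<bar>\<close> on the exponential and nothing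
  on the symbol.

  Summation over \<open>j\<close> gives \<open>\<bar>h\<bar>\<^sup>r\<close>, also in the limiting case \<open>r + 1/2 - \<rho> = s\<close>: the sum of
  \<open>2\<^bsup>-r j\<^esup> min 1 (2\<^sup>j \<bar>h\<bar>)\<close> is geometric on both sides of the scale \<open>2\<^bsup>-j\<^esup> \<sim> \<bar>h\<bar>\<close>, since \<open>0 < r < 1\<close>
  (\<open>dyadic_min_sum_le\<close>). Without the minimum the same series is a uniform bound for \<open>Op \<sigma> f\<close>, hence
  a bound for its \<open>L\<^sup>p\<close> norm.

  The zero frequency needs two remarks. The symbol there is the sum of its value and of its first
  difference at \<open>-1\<close>, so it obeys bounds of the same kind. The coefficient is the mean of \<open>f\<close>, which
  the seminorm does not see; it is controlled by the \<open>L\<^sup>p\<close> norm together with the seminorm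
  (\<open>norm_fourier_coeff_0_le\<close>).\<close>

section \<open>Haar measure, characters and Bessel's inequality\<close>

lemma haar_eq_density: "haar = density lebesgue (\<lambda>x. ennreal (indicator {0..<2 * pi} x / (2 * pi)))"
  unfolding haar_def uniform_measure_def
  by (intro arg_cong[where f = "density lebesgue"] ext)
     (simp add: indicator_def divide_ennreal[symmetric])

lemma emeasure_haar_UNIV: "emeasure haar UNIV = 1"
  unfolding haar_def by (subst emeasure_uniform_measure) (auto simp: divide_ennreal)

lemma
  fixes f :: "real \<Rightarrow> 'a::euclidean_space"
  assumes "continuous_on UNIV f"
  shows integrable_haar_continuous: "integrable haar f"
    and integral_haar_continuous: "integral\<^sup>L haar f = integral {0..2 * pi} f /\<^sub>R (2 * pi)"
proof -
  have meas: "f \<in> borel_measurable lebesgue"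
    using borel_measurable_continuous_onI[OF assms] by (intro measurable_completion) simp
  have cont: "continuous_on {0..2 * pi} f" using assms continuous_on_subset by blast
  have "integrable lebesgue (\<lambda>x. indicator {0..2 * pi} x *\<^sub>R f x)"
    and eq: "(LINT x|lebesgue. indicator {0..2 * pi} x *\<^sub>R f x) = integral {0..2 * pi} f"
    using absolutely_integrable_continuous_real[OF cont]
      set_lebesgue_integral_eq_integral(2)[OF absolutely_integrable_continuous_real[OF cont]]
    by (auto simp: set_integrable_def set_lebesgue_integral_def)
  moreover have ae: "AE x in lebesgue. indicator {0..2 * pi} x *\<^sub>R f x = indicator {0..<2 * pi} x *\<^sub>R f x"
    by (rule AE_I'[of "{2 * pi}"]) (auto simp: indicator_def split: if_splits)
  moreover have mI: "(\<lambda>x. indicator A x *\<^sub>R f x) \<in> borel_measurable lebesgue"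
    if "A \<in> sets borel" for A :: "real set"
    using meas that by (intro borel_measurable_scaleR borel_measurable_indicator) auto
  ultimately have int: "integrable lebesgue (\<lambda>x. indicator {0..<2 * pi} x *\<^sub>R f x)"
    using integrable_cong_AE[OF mI mI ae, simplified] by simp
  have eq': "(LINT x|lebesgue. indicator {0..<2 * pi} x *\<^sub>R f x) = integral {0..2 * pi} f"
    using integral_cong_AE[OF mI mI ae, simplified] eq by simp
  have scale: "(\<lambda>x. (indicator {0..<2 * pi} x / (2 * pi)) *\<^sub>R f x) =
      (\<lambda>x. (1 / (2 * pi)) *\<^sub>R (indicator {0..<2 * pi} x *\<^sub>R f x))" by (auto simp: fun_eq_iff)
  have weight: "(\<lambda>x. indicat_real {0..<2 * pi} x / (2 * pi)) \<in> borel_measurable lebesgue"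
    "AE x in lebesgue. 0 \<le> indicat_real {0..<2 * pi} x / (2 * pi)"
    by (auto intro!: borel_measurable_divide borel_measurable_indicator)
  show "integrable haar f"
    unfolding haar_eq_density integrable_density[OF meas weight] scale
    by (intro integrable_scaleR_right int)
  show "integral\<^sup>L haar f = integral {0..2 * pi} f /\<^sub>R (2 * pi)"
    unfolding haar_eq_density integral_density[OF meas weight] scale integral_scaleR_right eq'
    by (simp add: inverse_eq_divide)
qed

text \<open>Shifting by \<open>h\<close> moves the window to \<open>[-h, 2\<pi> - h]\<close>; its part left of \<open>0\<close> is carried by
  periodicity to the missing end \<open>[2\<pi> - h, 2\<pi>]\<close>.\<close>

lemma haar_translation_invariant:
  fixes f :: "real \<Rightarrow> complex"
  assumes cont: "continuous_on UNIV f" and per: "periodic_torus f" and h: "0 \<le> h" "h \<le> 2 * pi"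
  shows "(LINT x|haar. f (x - h)) = (LINT x|haar. f x)"
proof -
  interpret periodic_fun_simple f "2 * pi" by (rule per)
  have int: "f integrable_on {a..b}" for a b
    using cont continuous_on_subset by (intro integrable_continuous_real) blast
  have "integral {0..2 * pi} (\<lambda>x. f (x - h)) = integral {- h..2 * pi - h} f"
    using integral_shift_real_ivl[of "- h" h "2 * pi - h" "\<lambda>x. f (x - h)"]
    using integral_shift_real_ivl[of "-h" "- h" "2 * pi - h" f] by simp
  also have "\<dots> = integral {- h..0} f + integral {0..2 * pi - h} f"
    using h by (intro Henstock_Kurzweil_Integration.integral_combine[symmetric] int) auto
  also have "integral {- h..0} f = integral {2 * pi - h..2 * pi} f"
    using integral_shift_real_ivl[of "2 * pi - h" "2 * pi" "2 * pi" f] by (simp add: plus_period)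
  also have "\<dots> + integral {0..2 * pi - h} f = integral {0..2 * pi} f"
    by (subst add.commute, rule Henstock_Kurzweil_Integration.integral_combine)
       (use h int in auto)
  finally have "integral {0..2 * pi} (\<lambda>x. f (x - h)) = integral {0..2 * pi} f" .
  moreover have "continuous_on UNIV (\<lambda>x. f (x - h))"
    by (rule continuous_on_compose2[OF cont]) (auto intro!: continuous_intros)
  ultimately show ?thesis using cont by (simp add: integral_haar_continuous)
qed

definition character :: "int \<Rightarrow> real \<Rightarrow> complex" where
  "character k x = exp (\<i> * of_real (x * of_int k))"

lemma continuous_on_character [continuous_intros]: "continuous_on A (character k)"
  unfolding character_def by (intro continuous_intros)

lemma character_mult: "character k x * character l x = character (k + l) x"
  by (simp add: character_def exp_add[symmetric] algebra_simps)

lemma character_minus: "character (- k) x = cnj (character k x)"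
  by (simp add: character_def exp_cnj)

lemma norm_character [simp]: "cmod (character k x) = 1"
  by (simp add: character_def norm_exp_i_times)

lemma character_diff: "character k (x - h) = character k x * cnj (character k h)"
  by (simp add: character_def exp_cnj exp_add[symmetric] algebra_simps)

lemma character_0 [simp]: "character 0 x = 1"
  by (simp add: character_def)

lemma periodic_character: "periodic_torus (character k)"
proof
  fix x
  have "\<i> * of_real ((x + 2 * pi) * of_int k) = \<i> * of_real (x * of_int k) + of_int (2 * k) * of_real pi * \<i>"
    by (simp add: algebra_simps)
  also have "exp \<dots> = exp (\<i> * of_real (x * of_int k))"
    by (subst exp_add) (simp add: exp_integer_2pi[of "of_int k"] mult_ac)
  finally show "character k (x + 2 * pi) = character k x"
    by (simp add: character_def)
qed

lemma fourier_coeff_character: "fourier_coeff f k = (LINT x|haar. cnj (character k x) * f x)"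
  by (simp add: fourier_coeff_def character_def exp_cnj)

lemma Op_character: "Op \<sigma> f x = (\<Sum>\<^sub>\<infinity>k. character k x * \<sigma> x k * fourier_coeff f k)"
  by (simp add: Op_def character_def)

text \<open>A nontrivial character takes the value \<open>-1\<close> at some \<open>h\<close>, so translation by \<open>h\<close> multiplies its
  integral by \<open>-1\<close> and by invariance leaves it unchanged.\<close>

lemma integral_character: "(LINT x|haar. character k x) = (if k = 0 then 1 else 0)"
proof (cases "k = 0")
  case True
  then show ?thesis
    using emeasure_haar_UNIV by (simp add: measure_def haar_def)
next
  case False
  define h where "h = pi / \<bar>of_int k\<bar>"
  have "0 \<le> h" "h \<le> 2 * pi" using False by (auto simp: h_def field_simps)
  have "of_int k * h = pi \<or> of_int k * h = - pi"
    using False by (auto simp: h_def abs_if field_simps)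
  then have "character k h = -1"
    by (auto simp: character_def mult.commute[of h] exp_minus simp flip: of_real_mult)
  then have "(LINT x|haar. character k x) = (LINT x|haar. character k x * (-1))"
    using haar_translation_invariant[OF continuous_on_character periodic_character \<open>0 \<le> h\<close> \<open>h \<le> 2 * pi\<close>, of k]
    by (simp add: character_diff)
  then show ?thesis using False by simp
qed

text \<open>The square of the distance from \<open>g\<close> to its partial Fourier sum \<open>P\<close> over \<open>F\<close> is nonnegative. Both
  \<open>\<langle>g, P\<rangle>\<close> and \<open>\<langle>P, P\<rangle>\<close> equal the sum on the left, by orthogonality of the characters.\<close>

lemma bessel_inequality:
  assumes cont: "continuous_on UNIV g" and "finite F"
  shows "(\<Sum>k\<in>F. (cmod (fourier_coeff g k))\<^sup>2) \<le> (LINT x|haar. (cmod (g x))\<^sup>2)"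
proof -
  define c where "c = fourier_coeff g"
  define P where "P x = (\<Sum>k\<in>F. c k * character k x)" for x
  have cP: "continuous_on UNIV P" unfolding P_def by (intro continuous_intros)
  note int = integrable_haar_continuous
  have gP: "(LINT x|haar. cnj (P x) * g x) = (\<Sum>k\<in>F. of_real ((cmod (c k))\<^sup>2))"
  proof -
    have "(LINT x|haar. cnj (P x) * g x) = (LINT x|haar. (\<Sum>k\<in>F. cnj (c k) * (cnj (character k x) * g x)))"
      by (simp add: P_def sum_distrib_right mult.assoc)
    also have "\<dots> = (\<Sum>k\<in>F. (LINT x|haar. cnj (c k) * (cnj (character k x) * g x)))"
      by (intro Bochner_Integration.integral_sum int continuous_intros cont)
    also have "\<dots> = (\<Sum>k\<in>F. cnj (c k) * c k)"
      by (simp add: c_def fourier_coeff_character)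
    finally show ?thesis by (simp add: complex_norm_square mult.commute del: of_real_power)
  qed
  have PP: "(LINT x|haar. cnj (P x) * P x) = (\<Sum>k\<in>F. of_real ((cmod (c k))\<^sup>2))"
  proof -
    have "cnj (P x) * P x = (\<Sum>k\<in>F. \<Sum>l\<in>F. cnj (c k) * c l * character (l - k) x)" for x
    proof -
      have "cnj (P x) * P x = (\<Sum>k\<in>F. \<Sum>l\<in>F. cnj (c k) * c l * (character l x * character (- k) x))"
        unfolding P_def cnj_sum sum_product character_minus by (simp add: mult_ac)
      then show ?thesis by (simp only: character_mult) simp
    qed
    then have "(LINT x|haar. cnj (P x) * P x) =
        (LINT x|haar. (\<Sum>k\<in>F. \<Sum>l\<in>F. cnj (c k) * c l * character (l - k) x))" by simp
    also have "\<dots> = (\<Sum>k\<in>F. \<Sum>l\<in>F. LINT x|haar. cnj (c k) * c l * character (l - k) x)"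
      by (subst Bochner_Integration.integral_sum, (intro int continuous_intros)[1])
         (intro sum.cong refl Bochner_Integration.integral_sum int continuous_intros)
    also have "\<dots> = (\<Sum>k\<in>F. \<Sum>l\<in>F. if l = k then cnj (c k) * c k else 0)"
      by (intro sum.cong refl) (auto simp: integral_character)
    also have "\<dots> = (\<Sum>k\<in>F. cnj (c k) * c k)" using \<open>finite F\<close> by simp
    finally show ?thesis by (simp add: complex_norm_square mult.commute del: of_real_power)
  qed
  have pw: "(cmod (g x - P x))\<^sup>2 = (cmod (g x))\<^sup>2 - 2 * Re (cnj (P x) * g x) + Re (cnj (P x) * P x)" for x
    by (simp add: cmod_power2) (simp add: power2_eq_square algebra_simps)
  have "0 \<le> (LINT x|haar. (cmod (g x - P x))\<^sup>2)" by simp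
  also have "\<dots> = (LINT x|haar. (cmod (g x))\<^sup>2) - 2 * (LINT x|haar. Re (cnj (P x) * g x)) + (LINT x|haar. Re (cnj (P x) * P x))"
    unfolding pw
    by (subst Bochner_Integration.integral_add Bochner_Integration.integral_diff Bochner_Integration.integral_mult_right_zero;
        (intro int continuous_intros cont cP)?)+ simp
  also have "\<dots> = (LINT x|haar. (cmod (g x))\<^sup>2) - (\<Sum>k\<in>F. (cmod (c k))\<^sup>2)"
    by (simp add: integral_Re int continuous_intros cont cP gP PP del: complex_cnj_mult times_complex.sel)
  finally show ?thesis by (simp add: c_def)
qed

section \<open>Summation over dyadic shells of frequencies\<close>

text \<open>A weight comparable to \<open>1 + \<bar>k\<bar>\<close>: it is \<open>\<bar>k\<bar>\<close> away from \<open>0\<close>, and the value \<open>1\<close> at \<open>0\<close> puts the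
  zero frequency into the first dyadic shell, so that powers with negative exponents are harmless.\<close>

definition bracket :: "int \<Rightarrow> real" where
  "bracket k = max 1 \<bar>of_int k\<bar>"

definition dyadic_shell :: "nat \<Rightarrow> int set" where
  "dyadic_shell j = {k. 2 ^ j \<le> bracket k \<and> bracket k < 2 ^ Suc j}"

text \<open>The sums of the two geometric series, of ratios \<open>2\<^bsup>r - 1\<^esup>\<close> and \<open>2\<^bsup>-r\<^esup>\<close>, that appear when a sum over dyadic
  scales is split at the scale of the increment.\<close>

definition dyadic_const :: "real \<Rightarrow> real" where
  "dyadic_const r = 2 / (1 - 2 powr (r - 1)) + 1 / (1 - 2 powr (- r))"

lemma bracket_ge_1: "1 \<le> bracket k"
  by (simp add: bracket_def)

lemma bracket_ge_0 [simp]: "0 \<le> bracket k"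
  by (simp add: bracket_def)

lemma finite_bracket_less: "finite {k. bracket k < c}"
proof (rule finite_subset)
  show "{k. bracket k < c} \<subseteq> {- \<lceil>c\<rceil>..\<lceil>c\<rceil>}"
    by (auto simp: bracket_def; linarith)
qed simp

lemma finite_dyadic_shell: "finite (dyadic_shell j)"
  by (rule finite_subset[OF _ finite_bracket_less[of "2 ^ Suc j"]]) (auto simp: dyadic_shell_def)

lemma ex_dyadic_shell: "\<exists>j. k \<in> dyadic_shell j"
proof -
  define j where "j = nat \<lfloor>log 2 (bracket k)\<rfloor>"
  have *: "0 \<le> log 2 (bracket k)" using bracket_ge_1[of k] by simp
  then have "real j \<le> log 2 (bracket k)" "log 2 (bracket k) < real (Suc j)"
    by (auto simp: j_def) linarith+
  then have "2 powr real j \<le> bracket k" "bracket k < 2 powr real (Suc j)"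
    using bracket_ge_1[of k] by (auto simp: le_log_iff log_less_iff)
  then have "k \<in> dyadic_shell j"
    by (simp add: dyadic_shell_def powr_realpow[symmetric] del: of_nat_Suc power_Suc)
  then show ?thesis ..
qed

lemma sum_geometric_le:
  fixes q :: real
  assumes "0 \<le> q" "q < 1"
  shows "(\<Sum>i<n. q ^ i) \<le> 1 / (1 - q)"
  using sum_le_suminf[of "\<lambda>i. q ^ i" "{..<n}"] assms by (simp add: summable_geometric suminf_geometric)

text \<open>This sum is where \<open>0 < r < 1\<close> enters. Up to the scale \<open>2\<^sup>j \<sim> 1/t\<close> the terms are about \<open>2\<^bsup>(1 - r) j\<^esup> t\<close>,
  which grow geometrically because \<open>r < 1\<close>; beyond it they are \<open>2\<^bsup>-r j\<^esup>\<close>, which decay geometrically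
  because \<open>r > 0\<close>. Both parts are at most a constant times \<open>t\<^sup>r\<close>, the size at the splitting scale,
  so that no logarithm of \<open>t\<close> is lost.\<close>

lemma dyadic_min_sum_le:
  assumes r: "0 < r" "r < 1" and t: "0 < t"
  shows "(\<Sum>j<N. 2 powr (- r * real j) * min 1 (2 ^ Suc j * t)) \<le> dyadic_const r * t powr r"
proof -
  define q1 q2 :: real where "q1 = 2 powr (r - 1)" and "q2 = 2 powr (- r)"
  have q: "0 \<le> q1" "q1 < 1" "0 \<le> q2" "q2 < 1" using r by (auto simp: q1_def q2_def powr_less_one)
  define T where "T j = 2 powr (- r * real j) * min 1 (2 ^ Suc j * t)" for j
  have T1: "T j \<le> q2 ^ j" for j
  proof -
    have "T j \<le> 2 powr (- r * real j) * 1" unfolding T_def by (intro mult_left_mono) auto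
    then show ?thesis by (simp add: q2_def powr_powr flip: powr_realpow)
  qed
  \<comment> \<open>The splitting scale: \<open>2\<^sup>J t\<close> is at least \<open>1\<close>, and less than \<open>2\<close> unless \<open>J = 0\<close>.\<close>
  define J where "J = (LEAST j. 1 \<le> 2 ^ j * t)"
  obtain m where "1 / t < 2 ^ m" using real_arch_pow[of 2 "1/t"] by auto
  then have m: "1 \<le> 2 ^ m * t" using t by (simp add: field_simps)
  have J: "1 \<le> 2 ^ J * t" unfolding J_def by (rule LeastI[of _ m]) (rule m)
  have below: "2 ^ j * t < 1" if "j < J" for j
    using not_less_Least[of j "\<lambda>j. 1 \<le> 2 ^ j * t"] that unfolding J_def by auto
  have low: "(\<Sum>j<J. T j) \<le> 2 / (1 - q1) * t powr r"
  proof (cases J)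
    case 0
    then show ?thesis using q by simp
  next
    case (Suc n)
    have n: "2 ^ n * t \<le> 1" using below[of n] Suc by simp
    \<comment> \<open>Measured downwards from the last low scale \<open>n\<close>, the terms form a decreasing geometric progression.\<close>
    have "T j \<le> (2 * t * 2 powr ((1 - r) * real n)) * q1 ^ (n - j)" if "j \<le> n" for j
    proof -
      have "T j \<le> 2 powr (- r * real j) * (2 ^ Suc j * t)" unfolding T_def by (intro mult_left_mono) auto
      also have "\<dots> = 2 * t * (2 powr (- r * real j) * 2 powr (real j))" by (simp add: powr_realpow)
      also have "2 powr (- r * real j) * 2 powr (real j) = 2 powr ((1 - r) * real n) * q1 ^ (n - j)"
        using that by (simp add: q1_def powr_powr powr_add[symmetric] of_nat_diff algebra_simps flip: powr_realpow)
      finally show ?thesis by (simp add: mult_ac)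
    qed
    then have "(\<Sum>j<J. T j) \<le> (\<Sum>j<Suc n. (2 * t * 2 powr ((1 - r) * real n)) * q1 ^ (n - j))"
      unfolding Suc by (intro sum_mono) auto
    also have "\<dots> = (2 * t * 2 powr ((1 - r) * real n)) * (\<Sum>j<Suc n. q1 ^ j)"
      unfolding sum_distrib_left[symmetric]
      using sum.nat_diff_reindex[of "\<lambda>j. q1 ^ j" "Suc n"] by simp
    also have "\<dots> \<le> (2 * t * 2 powr ((1 - r) * real n)) * (1 / (1 - q1))"
      using t q by (intro mult_left_mono sum_geometric_le) auto
    also have "t * 2 powr ((1 - r) * real n) \<le> t powr r"
    proof -
      have "t * 2 powr ((1 - r) * real n) = t powr r * (2 ^ n * t) powr (1 - r)"
        using t by (simp add: powr_mult powr_add[symmetric] powr_powr mult_ac flip: powr_realpow)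
      also have "\<dots> \<le> t powr r * 1"
        using n t r by (intro mult_left_mono powr_le1) auto
      finally show ?thesis by simp
    qed
    then have "(2 * t * 2 powr ((1 - r) * real n)) * (1 / (1 - q1)) \<le> (2 * t powr r) * (1 / (1 - q1))"
      using q by (intro mult_right_mono) auto
    finally show ?thesis by simp
  qed
  have high: "(\<Sum>j\<in>{J..<J + n}. T j) \<le> 1 / (1 - q2) * t powr r" for n
  proof -
    have "(\<Sum>j\<in>{J..<J + n}. T j) \<le> (\<Sum>j\<in>{J..<J + n}. q2 ^ j)" by (intro sum_mono T1)
    also have "\<dots> = q2 ^ J * (\<Sum>j<n. q2 ^ j)"
      using sum.shift_bounds_nat_ivl[of "\<lambda>j. q2 ^ j" 0 J n]
      by (simp add: power_add sum_distrib_left atLeast0LessThan add.commute mult.commute)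
    also have "\<dots> \<le> t powr r * (1 / (1 - q2))"
    proof (intro mult_mono sum_geometric_le)
      have "q2 ^ J = (1 / 2 ^ J) powr r"
        by (simp add: q2_def powr_powr powr_divide powr_minus_divide mult.commute flip: powr_realpow)
      also have "\<dots> \<le> t powr r" using J r by (intro powr_mono2) (auto simp: field_simps)
      finally show "q2 ^ J \<le> t powr r" .
    qed (use q in \<open>auto intro: sum_nonneg\<close>)
    finally show ?thesis by (simp add: mult.commute)
  qed
  have "(\<Sum>j<N. T j) \<le> (\<Sum>j\<in>{..<J} \<union> {J..<J + N}. T j)"
    by (intro sum_mono2) (use t in \<open>auto simp: T_def\<close>)
  also have "\<dots> = (\<Sum>j<J. T j) + (\<Sum>j\<in>{J..<J + N}. T j)"
    by (intro sum.union_disjoint) auto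
  also have "\<dots> \<le> dyadic_const r * t powr r"
    using low high[of N] unfolding dyadic_const_def q1_def q2_def by (simp add: algebra_simps)
  finally show ?thesis by (simp only: T_def)
qed

lemma dyadic_const_pos: "0 < r \<Longrightarrow> r < 1 \<Longrightarrow> 0 < dyadic_const r"
  unfolding dyadic_const_def by (intro add_pos_pos divide_pos_pos) (auto simp: powr_less_one)

text \<open>Coefficients of size \<open>2\<^bsup>-r j\<^esup>\<close> on each shell give a function in the Hoelder class of order \<open>r\<close>:
  an increment of length \<open>t\<close> changes a summand of frequency \<open>k\<close>, relative to its size, by at most a
  multiple of \<open>min 1 (\<bar>k\<bar> t)\<close>.
  With \<open>t = 1\<close> the minimum is \<open>1\<close>, and the same bound gives absolute summability.\<close>

lemma dyadic_holder_sum_le: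
  assumes r: "0 < r" "r < 1" and t: "0 < t" and "finite F" and b: "\<And>k. 0 \<le> b k"
    and shell: "\<And>j. (\<Sum>k\<in>dyadic_shell j. b k) \<le> B * 2 powr (- r * real j)"
  shows "(\<Sum>k\<in>F. b k * min 1 (bracket k * t)) \<le> dyadic_const r * B * t powr r"
proof -
  obtain J where J: "\<And>k. k \<in> dyadic_shell (J k)" using ex_dyadic_shell by metis
  define N where "N = Suc (Max (J ` F))"
  have less: "J k < N" if "k \<in> F" for k
    using that \<open>finite F\<close> by (auto simp: N_def less_Suc_eq_le)
  have B: "0 \<le> B" using order_trans[OF sum_nonneg shell[of 0]] b by simp
  have "(\<Sum>k\<in>F. b k * min 1 (bracket k * t)) = (\<Sum>j<N. \<Sum>k\<in>{k\<in>F. J k = j}. b k * min 1 (bracket k * t))"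
    by (rule sum.group[symmetric]) (use \<open>finite F\<close> less in auto)
  also have "\<dots> \<le> (\<Sum>j<N. \<Sum>k\<in>dyadic_shell j. b k * min 1 (2 ^ Suc j * t))"
  proof (intro sum_mono)
    fix j
    have "(\<Sum>k\<in>{k\<in>F. J k = j}. b k * min 1 (bracket k * t)) \<le> (\<Sum>k\<in>dyadic_shell j. b k * min 1 (bracket k * t))"
      using J b t bracket_ge_0
      by (intro sum_mono2 finite_dyadic_shell mult_nonneg_nonneg) auto
    also have "\<dots> \<le> (\<Sum>k\<in>dyadic_shell j. b k * min 1 (2 ^ Suc j * t))"
      using t b by (intro sum_mono mult_left_mono min.mono mult_right_mono) (auto simp: dyadic_shell_def)
    finally show "(\<Sum>k\<in>{k\<in>F. J k = j}. b k * min 1 (bracket k * t)) \<le> \<dots>" .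
  qed
  also have "\<dots> \<le> (\<Sum>j<N. B * (2 powr (- r * real j) * min 1 (2 ^ Suc j * t)))"
    unfolding sum_distrib_right[symmetric] mult.assoc[symmetric]
    using t by (intro sum_mono mult_right_mono shell) auto
  also have "\<dots> \<le> B * (dyadic_const r * t powr r)"
    unfolding sum_distrib_left[symmetric] by (intro mult_left_mono dyadic_min_sum_le r t B)
  finally show ?thesis by (simp add: mult_ac)
qed

section \<open>Fourier coefficients of Hoelder continuous functions\<close>

lemma holder_continuous:
  fixes f :: "real \<Rightarrow> complex"
  assumes s: "0 < s" and f: "\<And>x h. cmod (f (x - h) - f x) \<le> A * \<bar>h\<bar> powr s"
  shows "continuous_on UNIV f"
proof -
  have "isCont f x" for x
  proof -
    have "((\<lambda>y. A * \<bar>x - y\<bar> powr s) \<longlongrightarrow> A * \<bar>x - x\<bar> powr s) (at x)"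
      using s by (intro tendsto_intros) auto
    then have lim: "((\<lambda>y. A * \<bar>x - y\<bar> powr s) \<longlongrightarrow> 0) (at x)" by simp
    have "((\<lambda>y. f y - f x) \<longlongrightarrow> 0) (at x)"
      by (rule Lim_null_comparison[OF always_eventually lim]) (use f[of x "x - y" for y] in simp)
    then show ?thesis by (simp add: isCont_def LIM_zero_iff)
  qed
  then show ?thesis by (simp add: continuous_at_imp_continuous_on)
qed

lemma fourier_coeff_difference:
  assumes "continuous_on UNIV f" "periodic_torus f" "0 \<le> h" "h \<le> 2 * pi"
  shows "fourier_coeff (\<lambda>x. f (x - h) - f x) k = (cnj (character k h) - 1) * fourier_coeff f k"
proof -
  interpret periodic_fun_simple f "2 * pi" by fact
  interpret c: periodic_fun_simple "character k" "2 * pi" by (rule periodic_character)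
  have cont: "continuous_on UNIV (\<lambda>x. f (x - h))"
    by (rule continuous_on_compose2[OF assms(1)]) (auto intro!: continuous_intros)
  have "(LINT x|haar. cnj (character k x) * f (x - h)) =
      (LINT x|haar. cnj (character k h) * (cnj (character k (x - h)) * f (x - h)))"
  proof (intro Bochner_Integration.integral_cong refl)
    fix x
    have "cnj (character k h) * character k h = 1"
      by (simp add: character_mult flip: character_minus)
    then show "cnj (character k x) * f (x - h) = cnj (character k h) * (cnj (character k (x - h)) * f (x - h))"
      by (simp add: character_diff)
  qed
  also have "\<dots> = cnj (character k h) * (LINT x|haar. cnj (character k (x - h)) * f (x - h))"
    by simp
  also have "(LINT x|haar. cnj (character k (x - h)) * f (x - h)) = fourier_coeff f k"
    unfolding fourier_coeff_character
    using assms(3,4)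
    by (intro haar_translation_invariant[where f = "\<lambda>x. cnj (character k x) * f x"])
       (auto intro!: continuous_intros assms(1) periodic_fun_simple.intro simp: plus_period c.plus_period)
  finally show ?thesis
    using assms(1) cont
    by (simp add: fourier_coeff_character right_diff_distrib left_diff_distrib
        Bochner_Integration.integral_diff integrable_haar_continuous continuous_intros)
qed

text \<open>When the phase \<open>k h\<close> lies between a quarter turn and a half turn, the difference operator of step
  \<open>h\<close> acts on the frequency \<open>k\<close> as multiplication by a number of modulus at least \<open>\<surd>2\<close>.\<close>

lemma norm_cnj_character_minus_1:
  assumes "pi / 2 \<le> \<bar>of_int k * h\<bar>" "\<bar>of_int k * h\<bar> \<le> pi"
  shows "2 \<le> (cmod (cnj (character k h) - 1))\<^sup>2"
proof -
  have "cos \<bar>of_int k * h\<bar> \<le> cos (pi / 2)"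
    using assms by (intro cos_monotone_0_pi_le) auto
  then have "cos (of_int k * h) \<le> 0" by simp
  moreover have "(cmod (cnj (character k h) - 1))\<^sup>2 = 2 - 2 * cos (of_int k * h)"
    using sin_cos_squared_add[of "of_int k * h"]
    unfolding cmod_power2
    by (simp add: character_def Re_exp Im_exp power2_eq_square algebra_simps)
  ultimately show ?thesis by simp
qed

text \<open>Bernstein's argument: apply Bessel's inequality to the increment \<open>f(x - h) - f(x)\<close>, which is
  \<open>O(h\<^sup>s)\<close> uniformly. The step \<open>h = \<pi> / 2\<^bsup>j + 1\<^esup>\<close> brings the phase of every frequency of the shell into
  \<open>[\<pi>/2, \<pi>]\<close>, so that the Fourier coefficients of the increment control those of \<open>f\<close>. The frequency
  \<open>0\<close> is left out because an increment does not see the mean of \<open>f\<close>.\<close>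

lemma fourier_l2_shell_le:
  assumes s: "0 < s" and f: "\<And>x h. cmod (f (x - h) - f x) \<le> A * \<bar>h\<bar> powr s"
    and per: "periodic_torus f"
  shows "(\<Sum>k\<in>dyadic_shell j - {0}. (cmod (fourier_coeff f k))\<^sup>2) \<le> (A * (pi / 2 ^ Suc j) powr s)\<^sup>2 / 2"
proof -
  define h where "h = pi / 2 ^ Suc j"
  have "(1 :: real) \<le> 2 * (2 * 2 ^ j)" using one_le_power[of "2 :: real" j] by linarith
  then have h: "0 < h" "h \<le> 2 * pi" by (auto simp: h_def field_simps)
  define g where "g x = f (x - h) - f x" for x
  have cont: "continuous_on UNIV f" by (rule holder_continuous[OF s f])
  have "continuous_on UNIV (\<lambda>x. f (x - h))"
    by (rule continuous_on_compose2[OF cont]) (auto intro!: continuous_intros)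
  then have cg: "continuous_on UNIV g" unfolding g_def by (intro continuous_intros cont)
  have "2 * (\<Sum>k\<in>dyadic_shell j - {0}. (cmod (fourier_coeff f k))\<^sup>2) \<le>
      (\<Sum>k\<in>dyadic_shell j - {0}. (cmod (fourier_coeff g k))\<^sup>2)"
    unfolding sum_distrib_left
  proof (intro sum_mono)
    fix k assume k: "k \<in> dyadic_shell j - {0}"
    then have "2 ^ j \<le> \<bar>of_int k :: real\<bar>" "\<bar>of_int k :: real\<bar> < 2 ^ Suc j"
      by (auto simp: dyadic_shell_def bracket_def)
    then have "pi / 2 \<le> \<bar>of_int k * h\<bar>" "\<bar>of_int k * h\<bar> \<le> pi"
      by (auto simp: h_def abs_mult field_simps)
    then have "2 * (cmod (fourier_coeff f k))\<^sup>2 \<le> (cmod (cnj (character k h) - 1))\<^sup>2 * (cmod (fourier_coeff f k))\<^sup>2"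
      by (intro mult_right_mono norm_cnj_character_minus_1) auto
    also have "\<dots> = (cmod (fourier_coeff g k))\<^sup>2"
      unfolding g_def using h by (subst fourier_coeff_difference[OF cont per]) (auto simp: norm_mult power_mult_distrib)
    finally show "2 * (cmod (fourier_coeff f k))\<^sup>2 \<le> (cmod (fourier_coeff g k))\<^sup>2" .
  qed
  also have "\<dots> \<le> (LINT x|haar. (cmod (g x))\<^sup>2)"
    by (intro bessel_inequality cg) (simp add: finite_dyadic_shell)
  also have "\<dots> \<le> (LINT x|haar. (A * h powr s)\<^sup>2)"
    using f[of _ h] h
    by (intro integral_mono integrable_haar_continuous continuous_intros cg power_mono) (auto simp: g_def)
  also have "\<dots> = (A * h powr s)\<^sup>2"
    using emeasure_haar_UNIV by (simp add: measure_def haar_def)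
  finally show ?thesis by (simp add: h_def)
qed

lemma card_dyadic_shell_le: "card (dyadic_shell j - {0}) \<le> 2 * 2 ^ j"
proof -
  have "dyadic_shell j - {0} \<subseteq> {2 ^ j..<2 ^ Suc j} \<union> uminus ` {2 ^ j..<2 ^ Suc j}"
  proof
    fix k assume "k \<in> dyadic_shell j - {0}"
    then have "real_of_int (2 ^ j) \<le> real_of_int \<bar>k\<bar>" "real_of_int \<bar>k\<bar> < real_of_int (2 ^ Suc j)"
      by (auto simp: dyadic_shell_def bracket_def)
    then have "2 ^ j \<le> \<bar>k\<bar>" "\<bar>k\<bar> < 2 ^ Suc j" by (simp_all only: of_int_le_iff of_int_less_iff)
    then have "k \<in> {2 ^ j..<2 ^ Suc j} \<or> - k \<in> {2 ^ j..<2 ^ Suc j}" by auto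
    then show "k \<in> {2 ^ j..<2 ^ Suc j} \<union> uminus ` {2 ^ j..<2 ^ Suc j}" by force
  qed
  then have "card (dyadic_shell j - {0}) \<le> card ({2 ^ j..<2 ^ Suc j} \<union> uminus ` {2 ^ j..<2 ^ Suc j :: int})"
    by (intro card_mono) auto
  also have "\<dots> \<le> card {2 ^ j..<2 ^ Suc j :: int} + card (uminus ` {2 ^ j..<2 ^ Suc j :: int})"
    by (rule card_Un_le)
  also have "\<dots> = 2 * 2 ^ j"
    by (simp add: card_image nat_power_eq)
  finally show ?thesis .
qed

text \<open>Cauchy-Schwarz over the roughly \<open>2\<^sup>j\<close> frequencies of a shell turns the \<open>\<ell>\<^sup>2\<close> bound \<open>2\<^bsup>-s j\<^esup>\<close> into the \<open>\<ell>\<^sup>1\<close>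
  bound \<open>2\<^bsup>(1/2 - s) j\<^esup>\<close>: this is the loss of half a derivative in the hypothesis \<open>r + 1/2 - \<rho> \<le> s\<close>.
  The decay \<open>\<rho>\<close> of the symbol then brings the exponent down to at most \<open>-r\<close>.\<close>

lemma fourier_l1_shell_le:
  assumes s: "0 < s" "s \<le> 1" and \<rho>: "0 \<le> \<rho>" and rs: "r + 1 / 2 - \<rho> \<le> s"
    and f: "\<And>x h. cmod (f (x - h) - f x) \<le> A * \<bar>h\<bar> powr s" and A: "0 \<le> A"
    and per: "periodic_torus f"
  shows "(\<Sum>k\<in>dyadic_shell j. bracket k powr (- \<rho>) * cmod (fourier_coeff f k))
    \<le> (2 * A + cmod (fourier_coeff f 0)) * 2 powr (- r * real j)"
proof -
  let ?a = "\<lambda>k. cmod (fourier_coeff f k)" and ?S = "dyadic_shell j - {0}"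
  have "(\<Sum>k\<in>?S. ?a k)\<^sup>2 \<le> real (card ?S) * (\<Sum>k\<in>?S. (?a k)\<^sup>2)"
    using Cauchy_Schwarz_ineq_sum[of "\<lambda>_. 1" ?a ?S] by simp
  also have "\<dots> \<le> (2 * 2 ^ j) * ((A * (pi / 2 ^ Suc j) powr s)\<^sup>2 / 2)"
  proof (intro mult_mono fourier_l2_shell_le s f per)
    show "real (card ?S) \<le> 2 * 2 ^ j"
      using card_dyadic_shell_le[of j] of_nat_le_iff[where 'a = real, of "card ?S" "2 * 2 ^ j"] by simp
  qed (auto intro: sum_nonneg)
  also have "\<dots> = (2 powr (real j / 2) * (A * (pi / 2 ^ Suc j) powr s))\<^sup>2"
    by (simp add: power_mult_distrib powr_realpow powr_power)
  finally have l1: "(\<Sum>k\<in>?S. ?a k) \<le> 2 powr (real j / 2) * (A * (pi / 2 ^ Suc j) powr s)"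
    by (rule power2_le_imp_le) (use A in auto)
  have "(pi / 2 ^ Suc j) powr s = (pi / 2) powr s * 2 powr (- s * real j)"
    by (simp add: powr_divide powr_mult powr_powr powr_minus_divide mult_ac flip: powr_realpow)
  also have "\<dots> \<le> 2 * 2 powr (- s * real j)"
  proof (rule mult_right_mono)
    have "(pi / 2) powr s \<le> 2 powr s"
      using pi_less_4 s by (intro powr_mono2) auto
    also have "\<dots> \<le> 2" using powr_mono[of s 1 2] s by simp
    finally show "(pi / 2) powr s \<le> 2" .
  qed simp
  finally have "2 powr (real j / 2) * (A * (pi / 2 ^ Suc j) powr s)
      \<le> 2 powr (real j / 2) * (A * (2 * 2 powr (- s * real j)))"
    using A by (intro mult_left_mono) auto
  also have "\<dots> = 2 * A * 2 powr (real j / 2 - s * real j)"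
    by (simp add: powr_diff powr_minus_divide)
  finally have l1: "(\<Sum>k\<in>?S. ?a k) \<le> 2 * A * 2 powr (real j / 2 - s * real j)"
    using l1 by linarith
  have "(\<Sum>k\<in>?S. bracket k powr (- \<rho>) * ?a k) \<le> (\<Sum>k\<in>?S. 2 powr (- \<rho> * real j) * ?a k)"
  proof (intro sum_mono mult_right_mono)
    fix k assume "k \<in> ?S"
    then have "bracket k powr (- \<rho>) \<le> (2 ^ j) powr (- \<rho>)"
      using \<rho> by (intro powr_mono2') (auto simp: dyadic_shell_def)
    also have "\<dots> = 2 powr (- \<rho> * real j)" by (simp add: powr_powr mult.commute flip: powr_realpow)
    finally show "bracket k powr (- \<rho>) \<le> 2 powr (- \<rho> * real j)" .
  qed auto
  also have "\<dots> \<le> 2 powr (- \<rho> * real j) * (2 * A * 2 powr (real j / 2 - s * real j))"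
    unfolding sum_distrib_left[symmetric] by (intro mult_left_mono l1) auto
  also have "\<dots> = 2 * A * 2 powr ((1 / 2 - \<rho> - s) * real j)"
    by (simp add: powr_add[symmetric] algebra_simps)
  also have "\<dots> \<le> 2 * A * 2 powr (- r * real j)"
    using rs A by (intro mult_left_mono powr_mono mult_right_mono) auto
  finally have nonzero: "(\<Sum>k\<in>?S. bracket k powr (- \<rho>) * ?a k) \<le> 2 * A * 2 powr (- r * real j)" .
  have zero: "(\<Sum>k\<in>dyadic_shell j \<inter> {0}. bracket k powr (- \<rho>) * ?a k) \<le> ?a 0 * 2 powr (- r * real j)"
  proof (cases j)
    case 0
    \<comment> \<open>The zero frequency belongs to the first shell only, where the power of \<open>2\<close> is \<open>1\<close>.\<close>
    then show ?thesis by (simp add: dyadic_shell_def bracket_def)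
  next
    case (Suc n)
    have "(1 :: real) \<le> 2 ^ n" by simp
    then have "dyadic_shell j \<inter> {0} = {}" using Suc by (auto simp: dyadic_shell_def bracket_def simp del: one_le_power)
    then show ?thesis by simp
  qed
  have "(\<Sum>k\<in>dyadic_shell j. bracket k powr (- \<rho>) * ?a k) =
      (\<Sum>k\<in>dyadic_shell j \<inter> {0}. bracket k powr (- \<rho>) * ?a k) + (\<Sum>k\<in>?S. bracket k powr (- \<rho>) * ?a k)"
    by (rule sum.Int_Diff[OF finite_dyadic_shell])
  then show ?thesis using zero nonzero by (simp add: algebra_simps)
qed

lemma character_lipschitz: "cmod (character k (x - h) - character k x) \<le> bracket k * \<bar>h\<bar>"
proof -
  have "character k (x - h) - character k x = character k x * (cnj (character k h) - 1)"
    by (simp add: character_diff right_diff_distrib)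
  then have "cmod (character k (x - h) - character k x) = cmod (character k x) * cmod (cnj (character k h) - 1)"
    by (simp only: norm_mult)
  also have "\<dots> = cmod (character k h - 1)"
    by (metis complex_cnj_diff complex_cnj_one complex_mod_cnj mult_1 norm_character)
  also have "\<dots> \<le> \<bar>h * of_int k\<bar>"
    using abs_sin_x_le_abs_x[of "h * of_int k / 2"] by (simp add: character_def dist_exp_i_1 del: of_real_mult)
  also have "\<dots> \<le> bracket k * \<bar>h\<bar>"
    by (simp add: abs_mult mult.commute[of "\<bar>h\<bar>"] bracket_def mult_right_mono)
  finally show ?thesis .
qed

section \<open>Pointwise estimates for the operator\<close>

lemma norm_infsum_le_finite_sums:
  fixes u :: "'a \<Rightarrow> 'b::banach"
  assumes "\<And>F. finite F \<Longrightarrow> (\<Sum>k\<in>F. norm (u k)) \<le> M"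
  shows "u summable_on A" "norm (infsum u A) \<le> M"
proof -
  have "(\<lambda>k. norm (u k)) summable_on A"
    using assms by (intro nonneg_bounded_partial_sums_imp_summable_on[of _ _ M])
      auto
  then show "u summable_on A" "norm (infsum u A) \<le> M"
    using assms norm_infsum_bound[of u A] infsum_le_finite_sums[of "\<lambda>k. norm (u k)" A M]
    by (auto intro: abs_summable_summable order_trans)
qed

text \<open>The summand of frequency \<open>k\<close> is at most \<open>K\<close> times the weighted Fourier coefficient \<open>b k\<close>. An
  increment \<open>h\<close> changes it by at most \<open>2 K b k\<close>, trivially, and by at most that times \<open>bracket k * \<bar>h\<bar>\<close>,
  because the character is Lipschitz with constant \<open>\<bar>k\<bar>\<close> and the symbol is Lipschitz in \<open>x\<close> with a
  constant that decays in \<open>k\<close> like its size. The bounds on shells then sum over all frequencies.\<close>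

lemma Op_holder_estimate:
  assumes s: "0 < s" "s \<le> 1" and \<rho>: "0 \<le> \<rho>" and r: "0 < r" "r < 1" and rs: "r + 1 / 2 - \<rho> \<le> s"
    and f: "\<And>x h. cmod (f (x - h) - f x) \<le> A * \<bar>h\<bar> powr s" and A: "0 \<le> A"
    and per: "periodic_torus f"
    and size: "\<And>x k. cmod (\<sigma> x k) \<le> K * bracket k powr (- \<rho>)"
    and lip: "\<And>x h k. cmod (\<sigma> (x - h) k - \<sigma> x k) \<le> K * bracket k powr (- \<rho>) * \<bar>h\<bar>"
  defines "M \<equiv> 2 * K * (dyadic_const r * (2 * A + cmod (fourier_coeff f 0)))"
  shows "cmod (Op \<sigma> f x) \<le> M"
    and "cmod (Op \<sigma> f (x - h) - Op \<sigma> f x) \<le> M * \<bar>h\<bar> powr r"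
proof -
  let ?a = "fourier_coeff f"
  define b where "b k = bracket k powr (- \<rho>) * cmod (?a k)" for k
  have b: "0 \<le> b k" for k by (simp add: b_def)
  have K: "0 \<le> K" using order_trans[OF norm_ge_zero size[of 0 0]] by (simp add: bracket_def)
  define u where "u x k = character k x * \<sigma> x k * ?a k" for x k
  have Op: "Op \<sigma> f x = infsum (u x) UNIV" for x unfolding Op_character u_def ..
  have sum_b: "(\<Sum>k\<in>F. 2 * K * (b k * min 1 (bracket k * t))) \<le> M * t powr r"
    if "finite F" "0 < t" for F t
  proof -
    have "(\<Sum>k\<in>F. b k * min 1 (bracket k * t)) \<le> dyadic_const r * (2 * A + cmod (?a 0)) * t powr r"
      unfolding b_def
      by (intro dyadic_holder_sum_le r that fourier_l1_shell_le[OF s \<rho> rs f A per]) auto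
    then show ?thesis
      unfolding M_def sum_distrib_left[symmetric] mult.assoc using K by (intro mult_left_mono) (auto simp: mult_ac)
  qed
  have size_u: "cmod (u x k) \<le> K * b k" for x k
    using mult_right_mono[OF size[of x k], of "cmod (?a k)"] by (simp add: u_def b_def norm_mult mult_ac)
  have sum_u: "(\<Sum>k\<in>F. cmod (u x k)) \<le> M" if "finite F" for F x
  proof -
    have "(\<Sum>k\<in>F. cmod (u x k)) \<le> (\<Sum>k\<in>F. 2 * K * (b k * min 1 (bracket k * 1)))"
      using K b by (intro sum_mono order_trans[OF size_u]) (auto simp: min_absorb1 bracket_ge_1)
    then show ?thesis using sum_b[OF that, of 1] by simp
  qed
  note summable = norm_infsum_le_finite_sums(1)[OF sum_u]
  show "cmod (Op \<sigma> f x) \<le> M" unfolding Op by (rule norm_infsum_le_finite_sums(2)[OF sum_u])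
  show "cmod (Op \<sigma> f (x - h) - Op \<sigma> f x) \<le> M * \<bar>h\<bar> powr r"
  proof (cases "h = 0")
    case False
    have diff_u: "cmod (u (x - h) k - u x k) \<le> 2 * K * (b k * min 1 (bracket k * \<bar>h\<bar>))" for k
    proof -
      have "cmod (u (x - h) k - u x k) \<le> cmod (u (x - h) k) + cmod (u x k)"
        by (rule norm_triangle_ineq4)
      also have "\<dots> \<le> 2 * K * b k" using size_u[of "x - h" k] size_u[of x k] by simp
      finally have trivial: "cmod (u (x - h) k - u x k) \<le> 2 * K * b k" .
      have "u (x - h) k - u x k = (character k (x - h) - character k x) * \<sigma> (x - h) k * ?a k
          + character k x * (\<sigma> (x - h) k - \<sigma> x k) * ?a k"
        by (simp add: u_def algebra_simps)
      also have "cmod \<dots> \<le> cmod (character k (x - h) - character k x) * cmod (\<sigma> (x - h) k) * cmod (?a k)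
          + cmod (\<sigma> (x - h) k - \<sigma> x k) * cmod (?a k)"
        by (rule order_trans[OF norm_triangle_ineq]) (simp add: norm_mult)
      also have "\<dots> \<le> (bracket k * \<bar>h\<bar>) * (K * bracket k powr (- \<rho>)) * cmod (?a k)
          + (K * bracket k powr (- \<rho>) * \<bar>h\<bar>) * cmod (?a k)"
        by (intro add_mono mult_right_mono mult_mono character_lipschitz size lip) auto
      also have "\<dots> = K * b k * (bracket k * \<bar>h\<bar> + 1 * \<bar>h\<bar>)"
        by (simp add: b_def algebra_simps)
      also have "\<dots> \<le> K * b k * (bracket k * \<bar>h\<bar> + bracket k * \<bar>h\<bar>)"
        using K b bracket_ge_1 by (intro mult_left_mono add_left_mono mult_right_mono) auto
      finally have "cmod (u (x - h) k - u x k) \<le> 2 * K * (b k * (bracket k * \<bar>h\<bar>))"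
        by (simp add: mult_ac)
      then show ?thesis using trivial by (simp add: min_def)
    qed
    have "(\<Sum>\<^sub>\<infinity>k. u (x - h) k + - u x k) = infsum (u (x - h)) UNIV + (\<Sum>\<^sub>\<infinity>k. - u x k)"
      by (intro infsum_add) (simp_all add: summable summable_on_uminus)
    then have "Op \<sigma> f (x - h) - Op \<sigma> f x = (\<Sum>\<^sub>\<infinity>k. u (x - h) k - u x k)"
      by (simp add: Op infsum_uminus)
    also have "cmod \<dots> \<le> M * \<bar>h\<bar> powr r"
      using False by (intro norm_infsum_le_finite_sums(2) order_trans[OF sum_mono[OF diff_u]] sum_b) auto
    finally show ?thesis .
  qed simp
qed

section \<open>The norms\<close>

lemma holder_seminorm_leD:
  assumes "holder_seminorm s f \<le> ennreal A" "0 \<le> A"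
  shows "cmod (f (x - h) - f x) \<le> A * \<bar>h\<bar> powr s"
proof (cases "h = 0")
  case False
  have "ennreal (cmod (f (x - h) - f x) / \<bar>h\<bar> powr s) \<le> holder_seminorm s f"
    unfolding holder_seminorm_def using False by (intro SUP_upper2[of "(x, h)"]) auto
  then have "cmod (f (x - h) - f x) / \<bar>h\<bar> powr s \<le> A"
    using assms by (metis ennreal_le_iff order_trans)
  then show ?thesis using False by (simp add: divide_le_eq)
qed simp

lemma holder_seminorm_leI:
  assumes "\<And>x h. cmod (f (x - h) - f x) \<le> A * \<bar>h\<bar> powr s"
  shows "holder_seminorm s f \<le> ennreal A"
  unfolding holder_seminorm_def
proof (intro SUP_least, clarify)
  fix x h :: real assume "h \<noteq> 0"
  then show "ennreal (cmod (f (x - h) - f x) / \<bar>h\<bar> powr s) \<le> ennreal A"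
    using assms[of x h] by (intro ennreal_leI) (simp add: divide_le_eq)
qed

lemma Lp_norm_leI:
  assumes p: "0 < p" and f: "\<And>x. cmod (f x) \<le> M"
  shows "Lp_norm p f \<le> ennreal M"
proof -
  have M: "0 \<le> M" using order_trans[OF norm_ge_zero f] .
  have "(\<integral>\<^sup>+ x. ennreal (cmod (f x) powr p) \<partial>haar) \<le> (\<integral>\<^sup>+ x. ennreal (M powr p) \<partial>haar)"
    using p f by (intro nn_integral_mono ennreal_leI powr_mono2) auto
  also have "\<dots> = ennreal (M powr p)"
    using emeasure_haar_UNIV by (simp add: haar_def)
  finally have I: "(\<integral>\<^sup>+ x. ennreal (cmod (f x) powr p) \<partial>haar) \<le> ennreal (M powr p)" .
  then have "enn2real (\<integral>\<^sup>+ x. ennreal (cmod (f x) powr p) \<partial>haar) powr (1 / p) \<le> (M powr p) powr (1 / p)"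
    using p by (intro powr_mono2 enn2real_leI) auto
  also have "\<dots> = M" using p M by (simp add: powr_powr)
  finally show ?thesis
    using I by (auto simp: Lp_norm_def Let_def top_unique intro: ennreal_leI)
qed

text \<open>Stated for bounds from below, so that the minimum of \<open>\<bar>f\<bar>\<close> over a period can be compared with
  its \<open>L\<^sup>p\<close> norm.\<close>

lemma le_Lp_norm:
  assumes p: "0 < p" and m: "0 \<le> m" "\<And>x. x \<in> {0..<2 * pi} \<Longrightarrow> m \<le> cmod (f x)"
  shows "ennreal m \<le> Lp_norm p f"
proof -
  have "ennreal (m powr p) = (\<integral>\<^sup>+ x. ennreal (m powr p) \<partial>haar)"
    using emeasure_haar_UNIV by (simp add: haar_def)
  also have "\<dots> \<le> (\<integral>\<^sup>+ x. ennreal (cmod (f x) powr p) \<partial>haar)"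
  proof (rule nn_integral_mono_AE)
    have "AE x in haar. x \<in> {0..<2 * pi}"
      unfolding haar_def by (rule AE_uniform_measureI) auto
    then show "AE x in haar. ennreal (m powr p) \<le> ennreal (cmod (f x) powr p)"
      using p m by (elim eventually_mono) (auto intro!: ennreal_leI powr_mono2)
  qed
  finally have I: "ennreal (m powr p) \<le> (\<integral>\<^sup>+ x. ennreal (cmod (f x) powr p) \<partial>haar)" .
  show ?thesis
  proof (cases "(\<integral>\<^sup>+ x. ennreal (cmod (f x) powr p) \<partial>haar)" rule: ennreal_cases)
    case (real i)
    then have "m powr p \<le> i" using I by simp
    then have "(m powr p) powr (1 / p) \<le> i powr (1 / p)" using p by (intro powr_mono2) auto
    then have "m \<le> i powr (1 / p)" using p m by (simp add: powr_powr)
    then show ?thesis using real by (simp add: Lp_norm_def ennreal_leI)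
  qed (simp add: Lp_norm_def)
qed

text \<open>The mean of \<open>f\<close> is invisible to the Hoelder seminorm, so here the \<open>L\<^sup>p\<close> part of the norm is used.
  The infimum of \<open>\<bar>f\<bar>\<close> over a period is at most the \<open>L\<^sup>p\<close> norm, since the measure has total mass \<open>1\<close>,
  and \<open>\<bar>f\<bar>\<close> exceeds it by at most the oscillation, which is bounded by \<open>A (2\<pi>)\<^sup>s \<le> 8 A\<close>.\<close>

lemma norm_fourier_coeff_0_le:
  assumes s: "0 < s" "s \<le> 1" and p: "0 < p"
    and f: "\<And>x h. cmod (f (x - h) - f x) \<le> A * \<bar>h\<bar> powr s" and A: "0 \<le> A"
    and N: "Lp_norm p f \<le> ennreal N" "0 \<le> N"
  shows "cmod (fourier_coeff f 0) \<le> 8 * A + N"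
proof -
  have cont: "continuous_on UNIV f" by (rule holder_continuous[OF s(1) f])
  have osc: "cmod (f x) \<le> cmod (f y) + 8 * A" if "x \<in> {0..<2 * pi}" "y \<in> {0..<2 * pi}" for x y
  proof -
    have "cmod (f x) \<le> cmod (f y) + cmod (f (y - (y - x)) - f y)"
      using norm_triangle_ineq[of "f y" "f x - f y"] by simp
    also have "cmod (f (y - (y - x)) - f y) \<le> A * \<bar>y - x\<bar> powr s" by (rule f)
    also have "\<dots> \<le> A * 8"
    proof (rule mult_left_mono[OF _ A])
      have "\<bar>y - x\<bar> powr s \<le> 8 powr s"
        using that pi_less_4 s by (intro powr_mono2) auto
      also have "\<dots> \<le> 8" using powr_mono[of s 1 8] s by simp
      finally show "\<bar>y - x\<bar> powr s \<le> 8" .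
    qed
    finally show ?thesis by simp
  qed
  have bound: "cmod (f x) \<le> 8 * A + N" if "x \<in> {0..<2 * pi}" for x
  proof -
    have "ennreal (max 0 (cmod (f x) - 8 * A)) \<le> Lp_norm p f"
      using osc[OF that] by (intro le_Lp_norm p) (auto simp: algebra_simps)
    then have "max 0 (cmod (f x) - 8 * A) \<le> N" using N by (metis ennreal_le_iff order_trans)
    then show ?thesis by simp
  qed
  have "cmod (fourier_coeff f 0) \<le> (LINT x|haar. cmod (f x))"
    by (simp add: fourier_coeff_def)
  also have "\<dots> \<le> (LINT x|haar. 8 * A + N)"
  proof (intro integral_mono_AE integrable_haar_continuous continuous_intros cont)
    have "AE x in haar. x \<in> {0..<2 * pi}"
      unfolding haar_def by (rule AE_uniform_measureI) auto
    then show "AE x in haar. cmod (f x) \<le> 8 * A + N"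
      by (elim eventually_mono) (rule bound)
  qed
  also have "\<dots> = 8 * A + N"
    using emeasure_haar_UNIV by (simp add: measure_def haar_def)
  finally show ?thesis .
qed

section \<open>Boundedness\<close>

lemma Op_bounded_of_symbol_bounds:
  assumes p: "0 < p" and s: "0 < s" "s \<le> 1" and \<rho>: "0 \<le> \<rho>" and r: "0 < r" "r < 1"
    and rs: "r + 1 / 2 - \<rho> \<le> s" and K: "0 < K"
    and size: "\<And>x k. cmod (\<sigma> x k) \<le> K * bracket k powr (- \<rho>)"
    and lip: "\<And>x h k. cmod (\<sigma> (x - h) k - \<sigma> x k) \<le> K * bracket k powr (- \<rho>) * \<bar>h\<bar>"
  shows "bounded_operator (B_norm s p) (B_norm r p) (Op \<sigma>)"
  unfolding bounded_operator_def
proof (intro exI conjI ballI)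
  show pos: "0 < 40 * K * dyadic_const r" using K dyadic_const_pos[OF r] by simp
  fix f assume "f \<in> smooth_torus"
  then have per: "periodic_torus f" by (simp add: smooth_torus_def)
  show "B_norm r p (Op \<sigma> f) \<le> ennreal (40 * K * dyadic_const r) * B_norm s p f"
  proof (cases "B_norm s p f" rule: ennreal_cases)
    case (real c)
    define A N where "A = enn2real (holder_seminorm s f)" and "N = enn2real (Lp_norm p f)"
    have fin: "holder_seminorm s f < top" "Lp_norm p f < top"
      using real by (auto simp: B_norm_def less_top[symmetric])
    then have AN: "holder_seminorm s f = ennreal A" "Lp_norm p f = ennreal N" "0 \<le> A" "0 \<le> N"
      by (simp_all add: A_def N_def)
    have f: "cmod (f (x - h) - f x) \<le> A * \<bar>h\<bar> powr s" for x h
      by (rule holder_seminorm_leD) (simp_all add: AN)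
    have a0: "cmod (fourier_coeff f 0) \<le> 8 * A + N"
      by (rule norm_fourier_coeff_0_le[OF s p f]) (simp_all add: AN)
    define M where "M = 2 * K * (dyadic_const r * (2 * A + cmod (fourier_coeff f 0)))"
    note est = Op_holder_estimate[OF s \<rho> r rs f AN(3) per size lip, folded M_def]
    have "0 \<le> M" using order_trans[OF norm_ge_zero est(1)] .
    have "B_norm r p (Op \<sigma> f) \<le> ennreal M + ennreal M"
      unfolding B_norm_def by (intro add_mono holder_seminorm_leI Lp_norm_leI p est)
    also have "\<dots> = ennreal (2 * M)" using \<open>0 \<le> M\<close> by (simp flip: ennreal_plus)
    also have "\<dots> \<le> ennreal (40 * K * dyadic_const r * (A + N))"
    proof (rule ennreal_leI)
      have "2 * M = 4 * K * dyadic_const r * (2 * A + cmod (fourier_coeff f 0))" by (simp add: M_def)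
      also have "\<dots> \<le> 4 * K * dyadic_const r * (10 * (A + N))"
        using a0 AN K dyadic_const_pos[OF r] by (intro mult_left_mono) auto
      finally show "2 * M \<le> 40 * K * dyadic_const r * (A + N)" by (simp add: algebra_simps)
    qed
    also have "\<dots> = ennreal (40 * K * dyadic_const r) * B_norm s p f"
      using AN pos by (simp add: B_norm_def ennreal_mult)
    finally show ?thesis .
  next
    case top
    moreover have "ennreal (40 * K * dyadic_const r) \<noteq> 0"
      using pos by (simp only: ennreal_eq_0_iff not_le)
    ultimately have "ennreal (40 * K * dyadic_const r) * B_norm s p f = top"
      by (simp only: ennreal_mult_top if_False)
    then show ?thesis by (simp only: top_greatest)
  qed
qed

text \<open>The mean value inequality, in the form in which the hypotheses on \<open>\<partial>\<^sub>x \<sigma>\<close> are used.\<close>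

lemma lipschitz_of_vector_derivative_bound:
  fixes g :: "real \<Rightarrow> complex"
  assumes "\<And>x. g differentiable (at x)" "\<And>x. cmod (vector_derivative g (at x)) \<le> L"
  shows "cmod (g (x - h) - g x) \<le> L * \<bar>h\<bar>"
proof -
  have "norm (g (x - h) - g x) \<le> L * norm (x - h - x)"
  proof (rule differentiable_bound[of UNIV])
    show "(g has_derivative (\<lambda>t. t *\<^sub>R vector_derivative g (at y))) (at y within UNIV)" for y
      using assms(1)[of y] by (simp add: vector_derivative_works has_vector_derivative_def)
    show "onorm (\<lambda>t. t *\<^sub>R vector_derivative g (at y)) \<le> L" for y
    proof (rule onorm_bound)
      show "0 \<le> L" by (rule order_trans[OF norm_ge_zero assms(2)])
      show "norm (t *\<^sub>R vector_derivative g (at y)) \<le> L * norm t" for t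
        using mult_right_mono[OF assms(2)[of y], of "\<bar>t\<bar>"] by (simp add: mult.commute)
    qed
  qed auto
  then show ?thesis by simp
qed

theorem theorem3p4:
  fixes p \<rho> :: real and \<sigma> :: "real \<Rightarrow> int \<Rightarrow> complex" and C :: "nat \<Rightarrow> real"
  assumes "1 < p" and "0 \<le> \<rho>" and "\<rho> \<le> 1"
    and "\<And>\<xi>. periodic_torus (\<lambda>x. \<sigma> x \<xi>)"
    and "(\<lambda>(x, \<xi>). \<sigma> x \<xi>) \<in> borel_measurable (haar \<Otimes>\<^sub>M count_space UNIV)"
    and "\<And>\<beta>. C \<beta> > 0"
    and "\<And>\<alpha> \<beta> \<xi>. \<alpha> \<le> 2 \<Longrightarrow> \<beta> \<le> nat \<lfloor>1 / p\<rfloor> + 1 \<Longrightarrow> \<xi> \<noteq> 0 \<Longrightarrow>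
           times_differentiable \<beta> (\<lambda>x. (diff_xi ^^ \<alpha>) \<sigma> x \<xi>)"
    and "\<And>\<alpha> \<beta> x \<xi>. \<alpha> \<le> 2 \<Longrightarrow> \<beta> \<le> nat \<lfloor>1 / p\<rfloor> + 1 \<Longrightarrow> \<xi> \<noteq> 0 \<Longrightarrow>
           cmod (deriv_x \<beta> (\<lambda>x. (diff_xi ^^ \<alpha>) \<sigma> x \<xi>) x)
             \<le> C \<beta> * real_of_int \<bar>\<xi>\<bar> powr (- \<rho> - real \<alpha>)"
  shows "\<forall>r s. 0 < r \<and> r < 1 \<and> 0 < s \<and> s \<le> 1 \<and> r + 1 / 2 - \<rho> \<le> s \<longrightarrow>
           bounded_operator (B_norm s p) (B_norm r p) (Op \<sigma>)"
proof -
  \<comment> \<open>The factors \<open>2\<close> are for the frequency \<open>0\<close>, where the bounds on the symbol and on its first difference at \<open>-1\<close> add up.\<close>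
  define K where "K = 2 * C 0 + 2 * C 1"
  have K: "0 < K" "C 0 \<le> K" "2 * C 0 \<le> K" "C 1 \<le> K" "2 * C 1 \<le> K"
    using assms(6)[of 0] assms(6)[of 1] by (auto simp: K_def)
  have size: "cmod ((diff_xi ^^ \<alpha>) \<sigma> x \<xi>) \<le> C 0 * real_of_int \<bar>\<xi>\<bar> powr (- \<rho> - real \<alpha>)"
    if "\<alpha> \<le> 2" "\<xi> \<noteq> 0" for \<alpha> \<xi> x
    using assms(8)[of \<alpha> 0 \<xi> x] that by (simp add: deriv_x_def)
  have lip: "cmod ((diff_xi ^^ \<alpha>) \<sigma> (x - h) \<xi> - (diff_xi ^^ \<alpha>) \<sigma> x \<xi>)
      \<le> C 1 * real_of_int \<bar>\<xi>\<bar> powr (- \<rho> - real \<alpha>) * \<bar>h\<bar>"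
    if "\<alpha> \<le> 2" "\<xi> \<noteq> 0" for \<alpha> \<xi> x h
  proof (rule lipschitz_of_vector_derivative_bound[where g = "\<lambda>x. (diff_xi ^^ \<alpha>) \<sigma> x \<xi>"])
    show "(\<lambda>x. (diff_xi ^^ \<alpha>) \<sigma> x \<xi>) differentiable at y" for y
      using assms(7)[of \<alpha> 1 \<xi>] that by (simp add: times_differentiable_def deriv_x_def)
    show "cmod (vector_derivative (\<lambda>x. (diff_xi ^^ \<alpha>) \<sigma> x \<xi>) (at y))
        \<le> C 1 * real_of_int \<bar>\<xi>\<bar> powr (- \<rho> - real \<alpha>)" for y
      using assms(8)[of \<alpha> 1 \<xi> y] that by (simp add: deriv_x_def)
  qed
  have br: "bracket k = real_of_int \<bar>k\<bar>" if "k \<noteq> 0" for k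
    using that by (auto simp: bracket_def)
  have br0: "bracket 0 = 1" by (simp add: bracket_def)
  have size': "cmod (\<sigma> x k) \<le> K * bracket k powr (- \<rho>)" for x k
  proof (cases "k = 0")
    case True
    \<comment> \<open>At the frequency \<open>0\<close>, step up from \<open>-1\<close> with the bound on the first difference there.\<close>
    have "\<sigma> x 0 = \<sigma> x (- 1) + (diff_xi ^^ 1) \<sigma> x (- 1)" by (simp add: diff_xi_def)
    also have "cmod \<dots> \<le> cmod (\<sigma> x (- 1)) + cmod ((diff_xi ^^ 1) \<sigma> x (- 1))" by (rule norm_triangle_ineq)
    also have "\<dots> \<le> 2 * C 0" using size[of 0 "-1" x] size[of 1 "-1" x] by simp
    finally show ?thesis using True K by (simp add: br0)
  next
    case False
    have "cmod (\<sigma> x k) \<le> C 0 * bracket k powr (- \<rho>)" using size[of 0 k x] False by (simp add: br)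
    also have "\<dots> \<le> K * bracket k powr (- \<rho>)" using K by (intro mult_right_mono) auto
    finally show ?thesis .
  qed
  have lip': "cmod (\<sigma> (x - h) k - \<sigma> x k) \<le> K * bracket k powr (- \<rho>) * \<bar>h\<bar>" for x h k
  proof (cases "k = 0")
    case True
    have "\<sigma> (x - h) 0 - \<sigma> x 0 = (\<sigma> (x - h) (- 1) - \<sigma> x (- 1))
        + ((diff_xi ^^ 1) \<sigma> (x - h) (- 1) - (diff_xi ^^ 1) \<sigma> x (- 1))" by (simp add: diff_xi_def)
    also have "cmod \<dots> \<le> cmod (\<sigma> (x - h) (- 1) - \<sigma> x (- 1))
        + cmod ((diff_xi ^^ 1) \<sigma> (x - h) (- 1) - (diff_xi ^^ 1) \<sigma> x (- 1))" by (rule norm_triangle_ineq)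
    also have "\<dots> \<le> 2 * C 1 * \<bar>h\<bar>" using lip[of 0 "-1" x h] lip[of 1 "-1" x h] by simp
    also have "\<dots> \<le> K * \<bar>h\<bar>" using K by (intro mult_right_mono) auto
    finally show ?thesis using True by (simp add: br0)
  next
    case False
    have "cmod (\<sigma> (x - h) k - \<sigma> x k) \<le> C 1 * bracket k powr (- \<rho>) * \<bar>h\<bar>"
      using lip[of 0 k x h] False by (simp add: br)
    also have "\<dots> \<le> K * bracket k powr (- \<rho>) * \<bar>h\<bar>" using K by (intro mult_right_mono) auto
    finally show ?thesis .
  qed
  show ?thesis
  proof (intro allI impI, elim conjE)
    fix r s assume "0 < r" "r < 1" "0 < s" "s \<le> 1" "r + 1 / 2 - \<rho> \<le> s"
    then show "bounded_operator (B_norm s p) (B_norm r p) (Op \<sigma>)"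
      using assms(1,2) K(1) by (intro Op_bounded_of_symbol_bounds[OF _ _ _ _ _ _ _ _ size' lip']) simp_all
  qed
qed

end
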